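(* For all positive integers $m,h,p$ and every integer $k$, $$hm^{p}S_{p}^{(k)}(h,m)+mh^{p}S_{p}^{(k)}(m,h)=\sum_{\mu=0}^{m-1}\sum_{j=0}^{p}\sum_{\nu=0}^{h-1}\sum_{l=1}^{p-j+1}\frac{(mh)^{j-1}\binom{p}{j}S_{1}(p-j+1,l)}{(p-j+1)\,l^{k-1}}\big((\mu h)m^{p-j}+(m\nu)h^{p-j}\big)\overline{B}_{j}\Big(\frac{\nu}{h}+\frac{\mu}{m}\Big).$$
   Context: For $k\in\mathbb{Z}$, the polyexponential function of index $k$ is $\mathrm{Ei}_{k}(x)=\sum_{n=1}^{\infty}\frac{x^{n}}{n^{k}(n-1)!}$. The type 2 poly-Bernoulli polynomials of index $k$, $B_n^{(k)}(x)$, are defined by the (formal power series in $t$) identity $\frac{\mathrm{Ei}_{k}(\log(1+t))}{e^{t}-1}e^{xt}=\sum_{n=0}^{\infty}B_{n}^{(k)}(x)\frac{t^{n}}{n!}$. The Bernoulli polynomials $B_n(x)$ are defined by $\frac{t}{e^{t}-1}e^{xt}=\sum_{n=0}^{\infty}B_{n}(x)\frac{t^{n}}{n!}$. For real $x$, $\langle x\rangle=x-[x]$ is the fractional part, where $[x]$ is the greatest integer not exceeding $x$; $\overline{B}_n(x)=B_n(\langle x\rangle)$ and $\overline{B}_n^{(k)}(x)=B_n^{(k)}(\langle x\rangle)$. For positive integers $h,m,p$ and $k\in\mathbb{Z}$, the poly-Dedekind sum is $S_{p}^{(k)}(h,m)=\sum_{\mu=1}^{m-1}\frac{\mu}{m}\,\overline{B}_{p}^{(k)}\big(\frac{h\mu}{m}\big)$.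 $S_1(n,l)$ denotes the (signed) Stirling numbers of the first kind, given by $\frac{(\log(1+t))^{l}}{l!}=\sum_{n=l}^{\infty}S_1(n,l)\frac{t^n}{n!}$. *)

theory Defs
  imports "HOL-Computational_Algebra.Formal_Power_Series"
begin

definition polyexp_fps :: "int \<Rightarrow> real fps" where
  "polyexp_fps k = Abs_fps (\<lambda>n. if n = 0 then 0 else 1 / (real n powi k * fact (n - 1)))"

text \<open>
  In the generating functions below, \<open>fps_X\<close> plays the role of the formal variable \<open>t\<close>, so that
  \<open>fps_exp c\<close> is $e^{ct}$ and \<open>fps_ln 1\<close> is $\log(1+t)$.  The denominator
  \<open>fps_exp 1 - 1\<close> is not a unit, but both numerators have zero constant term, so the divisions
  are exact; see \<open>bernoulli_poly_gf\<close> and \<open>poly_bernoulli_poly_gf\<close>.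
\<close>

definition bernoulli_poly :: "nat \<Rightarrow> real \<Rightarrow> real" where
  "bernoulli_poly n x = fact n * fps_nth (fps_X / (fps_exp 1 - 1) * fps_exp x) n"

definition poly_bernoulli_poly :: "int \<Rightarrow> nat \<Rightarrow> real \<Rightarrow> real" where
  "poly_bernoulli_poly k n x =
     fact n * fps_nth ((polyexp_fps k oo fps_ln 1) / (fps_exp 1 - 1) * fps_exp x) n"

definition periodic_bernoulli :: "nat \<Rightarrow> real \<Rightarrow> real" where
  "periodic_bernoulli n x = bernoulli_poly n (frac x)"

definition periodic_poly_bernoulli :: "int \<Rightarrow> nat \<Rightarrow> real \<Rightarrow> real" where
  "periodic_poly_bernoulli k n x = poly_bernoulli_poly k n (frac x)"

definition poly_dedekind_sum :: "int \<Rightarrow> nat \<Rightarrow> nat \<Rightarrow> nat \<Rightarrow> real" where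
  "poly_dedekind_sum k p h m =
     (\<Sum>\<mu> = 1..m - 1. real \<mu> / real m * periodic_poly_bernoulli k p (real h * real \<mu> / real m))"

text \<open>
  Signed Stirling numbers of the first kind; the library's \<open>stirling\<close> is the unsigned version.
\<close>

definition stirling1 :: "nat \<Rightarrow> nat \<Rightarrow> real" where
  "stirling1 n l = fact n * fps_nth (fps_const (1 / fact l) * fps_ln 1 ^ l) n"

lemma exp_minus_1_dvd:
  fixes f :: "real fps"
  assumes "fps_nth f 0 = 0"
  shows "fps_exp 1 - 1 dvd f"
proof -
  have s: "subdegree (fps_exp 1 - 1 :: real fps) = 1"
    by (rule subdegreeI) auto
  hence nz: "fps_exp 1 - 1 \<noteq> (0 :: real fps)"
    by auto
  show ?thesis
  proof (cases "f = 0")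
    case False
    hence "subdegree f \<noteq> 0"
      using assms by (metis nth_subdegree_nonzero)
    thus ?thesis
      using s nz False by (simp add: fps_dvd_iff)
  qed simp
qed

lemma bernoulli_poly_gf:
  "(fps_exp 1 - 1) * Abs_fps (\<lambda>n. bernoulli_poly n x / fact n) = fps_X * fps_exp x"
proof -
  have "Abs_fps (\<lambda>n. bernoulli_poly n x / fact n) = fps_X / (fps_exp 1 - 1) * fps_exp x"
    by (simp add: fps_eq_iff bernoulli_poly_def)
  moreover have "(fps_exp 1 - 1) * (fps_X / (fps_exp 1 - 1)) = (fps_X :: real fps)"
    by (intro dvd_mult_div_cancel exp_minus_1_dvd) simp
  ultimately show ?thesis
    by (simp add: mult.assoc [symmetric])
qed

lemma poly_bernoulli_poly_gf:
  "(fps_exp 1 - 1) * Abs_fps (\<lambda>n. poly_bernoulli_poly k n x / fact n) =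
     (polyexp_fps k oo fps_ln 1) * fps_exp x"
proof -
  have "Abs_fps (\<lambda>n. poly_bernoulli_poly k n x / fact n) =
      (polyexp_fps k oo fps_ln 1) / (fps_exp 1 - 1) * fps_exp x"
    by (simp add: fps_eq_iff poly_bernoulli_poly_def)
  moreover have "(fps_exp 1 - 1) * ((polyexp_fps k oo fps_ln 1) / (fps_exp 1 - 1)) =
      polyexp_fps k oo fps_ln 1"
    by (intro dvd_mult_div_cancel exp_minus_1_dvd) (simp add: polyexp_fps_def)
  ultimately show ?thesis
    by (simp add: mult.assoc [symmetric])
qed

end

theory Submission
  imports Defs
begin

text \<open>
  Dividing $\mathrm{Ei}_k(\log(1+t))$ by $t$ expresses $B_n^{(k)}(x)$ as a binomial
  combination of the ordinary $B_j(x)$, with coefficients given by Stirling numbers.  Raabe's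
  multiplication formula $\overline{B}_j(hx) = h^{j-1} \sum_{\nu<h} \overline{B}_j(x + \nu/h)$ at
  $x = \mu/m$ then spreads each term of $S_p^{(k)}(h,m)$ over the points $\nu/h + \mu/m$, and
  the other sum is treated by exchanging $(h,\nu)$ with $(m,\mu)$.
\<close>

definition polyexp_coeff :: "int \<Rightarrow> nat \<Rightarrow> real" where
  "polyexp_coeff k i = (\<Sum>l = 1..i + 1. stirling1 (i + 1) l / (real (i + 1) * real l powi (k - 1)))"

text \<open>Power series over the reals have no zero divisors, so being nonzero lets this non-unit
  be cancelled from both sides of an equation.\<close>

lemma fps_exp_minus_1_nonzero: "c \<noteq> 0 \<Longrightarrow> fps_exp c - 1 \<noteq> (0 :: real fps)"
  by (auto simp: fps_eq_iff dest: spec [of _ 1])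

text \<open>Since $l^k (l-1)! = l^{k-1} l!$, each summand of the composition is $(log(1+t))^l / l!$
  divided by $l^{k-1}$, and the first factor generates the Stirling numbers.\<close>

lemma polyexp_compose_ln_nth:
  "fact n * fps_nth (polyexp_fps k oo fps_ln 1) n =
     (\<Sum>l = 1..n. stirling1 n l / real l powi (k - 1))"
proof -
  have *: "fact n * (fps_nth (polyexp_fps k) l * fps_nth (fps_ln 1 ^ l) n) =
      stirling1 n l / real l powi (k - 1)" if "l \<in> {1..n}" for l
  proof -
    from that have "l > 0" by simp
    hence "real l powi k = real l powi (k - 1) * real l" "fact l = real l * fact (l - 1)"
      by (simp_all add: power_int_diff fact_reduce)
    with \<open>l > 0\<close> show ?thesis
      by (simp add: polyexp_fps_def stirling1_def)
  qed
  have "fact n * fps_nth (polyexp_fps k oo fps_ln 1) n =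
      (\<Sum>l = 0..n. fact n * (fps_nth (polyexp_fps k) l * fps_nth (fps_ln 1 ^ l) n))"
    by (simp add: fps_compose_nth sum_distrib_left)
  \<comment> \<open>The term $l = 0$ drops out because \<open>polyexp_fps k\<close> has zero
    constant coefficient.\<close>
  also have "\<dots> = (\<Sum>l = 1..n. fact n * (fps_nth (polyexp_fps k) l * fps_nth (fps_ln 1 ^ l) n))"
    by (intro sum.mono_neutral_right) (auto simp: polyexp_fps_def)
  finally show ?thesis
    using * by simp
qed

lemma polyexp_compose_ln_eq:
  "polyexp_fps k oo fps_ln 1 = fps_X * Abs_fps (\<lambda>i. polyexp_coeff k i / fact i)"
proof (rule fps_ext)
  fix n
  show "fps_nth (polyexp_fps k oo fps_ln 1) n =
      fps_nth (fps_X * Abs_fps (\<lambda>i. polyexp_coeff k i / fact i)) n"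
  proof (cases n)
    case 0
    thus ?thesis by (simp add: polyexp_fps_def)
  next
    case (Suc i)
    \<comment> \<open>The factor $n$ cancels the denominator $i+1$ in \<open>polyexp_coeff\<close>,
      and also turns $n!$ into $i!$.\<close>
    have "fact n * fps_nth (polyexp_fps k oo fps_ln 1) n = real n * polyexp_coeff k i"
      unfolding polyexp_compose_ln_nth polyexp_coeff_def sum_distrib_left
      using Suc by (intro sum.cong) auto
    thus ?thesis
      using Suc by (simp add: field_simps del: of_nat_Suc)
  qed
qed

text \<open>After cancelling $e^t - 1$, the generating function is a product of two exponential
  generating functions, whose coefficients form a binomial convolution.\<close>

lemma poly_bernoulli_poly_eq_sum:
  "poly_bernoulli_poly k n x =
     (\<Sum>j = 0..n. real (n choose j) * polyexp_coeff k (n - j) * bernoulli_poly j x)"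
proof -
  let ?A = "Abs_fps (\<lambda>i. polyexp_coeff k i / fact i)"
  let ?B = "Abs_fps (\<lambda>n. bernoulli_poly n x / fact n)"
  let ?P = "Abs_fps (\<lambda>n. poly_bernoulli_poly k n x / fact n)"
  have "(fps_exp 1 - 1) * ?P = (fps_exp 1 - 1) * (?B * ?A)"
    unfolding poly_bernoulli_poly_gf polyexp_compose_ln_eq mult.assoc [symmetric]
      bernoulli_poly_gf by (simp only: mult_ac)
  hence "?P = ?B * ?A"
    using fps_exp_minus_1_nonzero [of 1] by simp
  from arg_cong [OF this, of "\<lambda>F. fact n * fps_nth F n"] show ?thesis
    by (simp add: fps_mult_nth sum_distrib_left binomial_fact field_simps)
qed

lemma bernoulli_poly_multiplication:
  assumes "h > 0"
  shows "bernoulli_poly j (real h * x) =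
    real h powi (int j - 1) * (\<Sum>\<nu><h. bernoulli_poly j (x + real \<nu> / real h))"
proof -
  define c where "c = 1 / real h"
  have c: "c \<noteq> 0" "c * real h = 1" "c * real \<nu> = real \<nu> / real h" for \<nu>
    using assms by (simp_all add: c_def)
  define G where "G = (\<lambda>y. Abs_fps (\<lambda>n. bernoulli_poly n y / fact n))"
  have G: "(fps_exp 1 - 1) * G y = fps_X * fps_exp y" for y
    unfolding G_def by (rule bernoulli_poly_gf)
  have "fps_exp c ^ h = (fps_exp 1 :: real fps)"
    using c by (simp add: fps_exp_power_mult mult.commute)
  hence geom: "(fps_exp c - 1) * (\<Sum>\<nu><h. fps_exp (c * real \<nu>)) = (fps_exp 1 - 1 :: real fps)"
    using power_diff_1_eq [of "fps_exp c :: real fps" h]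
    by (simp add: fps_exp_power_mult mult.commute)
  have "(fps_exp 1 - 1) * ((fps_exp c - 1) * (\<Sum>\<nu><h. G (x + c * real \<nu>))) =
      (fps_exp c - 1) * (\<Sum>\<nu><h. (fps_exp 1 - 1) * G (x + c * real \<nu>))"
    by (simp only: sum_distrib_left mult_ac)
  also have "\<dots> = fps_X * fps_exp x * ((fps_exp c - 1) * (\<Sum>\<nu><h. fps_exp (c * real \<nu>)))"
    by (simp only: G fps_exp_add_mult sum_distrib_left mult_ac)
  also have "\<dots> = (fps_exp 1 - 1) * (fps_X * fps_exp x)"
    by (simp only: geom mult_ac)
  finally have sum: "(fps_exp c - 1) * (\<Sum>\<nu><h. G (x + c * real \<nu>)) = fps_X * fps_exp x"
    using fps_exp_minus_1_nonzero [of 1] by simp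
  \<comment> \<open>Replacing $t$ by $ct$ turns $e^{hxt}$ into $e^{xt}$, so up to the factor $c$ the
    right-hand side becomes the one in \<open>sum\<close>.\<close>
  have "((fps_exp 1 - 1) * G (real h * x)) oo (fps_const c * fps_X) =
      (fps_X * fps_exp (real h * x)) oo (fps_const c * fps_X)"
    by (simp only: G)
  hence "(fps_exp c - 1) * (G (real h * x) oo (fps_const c * fps_X)) =
      fps_const c * (fps_X * fps_exp x)"
    using c by (simp add: fps_compose_mult_distrib fps_compose_sub_distrib
        fps_exp_compose_linear mult.assoc [symmetric])
  also have "\<dots> = (fps_exp c - 1) * (fps_const c * (\<Sum>\<nu><h. G (x + c * real \<nu>)))"
    by (simp only: sum [symmetric] mult_ac)
  finally have "G (real h * x) oo (fps_const c * fps_X) =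
      fps_const c * (\<Sum>\<nu><h. G (x + c * real \<nu>))"
    using fps_exp_minus_1_nonzero [OF c(1)] by simp
  from arg_cong [OF this, of "\<lambda>F. fact j * fps_nth F j"]
  have "c ^ j * bernoulli_poly j (real h * x) =
      c * (\<Sum>\<nu><h. bernoulli_poly j (x + real \<nu> / real h))"
    by (simp add: G_def fps_compose_linear fps_sum_nth c(3) sum_divide_distrib [symmetric])
  thus ?thesis
    using assms by (simp add: c_def power_int_diff field_simps)
qed

text \<open>A shift by $1/h$ moves the window of indices by one; the term that enters and the term
  that leaves differ by a full period.\<close>

lemma sum_shift_by_period:
  fixes f :: "real \<Rightarrow> 'a :: ab_group_add"
  assumes "\<And>x. f (x + 1) = f x" and "h > 0"
  shows "(\<Sum>\<nu><h. f (x + of_int c / real h + real \<nu> / real h)) = (\<Sum>\<nu><h. f (x + real \<nu> / real h))"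
proof -
  define S where "S = (\<lambda>x. \<Sum>\<nu><h. f (x + real \<nu> / real h))"
  have step: "S (x + 1 / real h) = S x" for x
  proof -
    let ?g = "\<lambda>\<nu>. f (x + real \<nu> / real h)"
    have "S (x + 1 / real h) = (\<Sum>\<nu><h. ?g (Suc \<nu>))"
      by (simp add: S_def add_divide_distrib add_ac)
    also have "\<dots> = S x + (?g h - ?g 0)"
      using sum_lessThan_telescope [of ?g h] by (simp add: S_def sum_subtractf algebra_simps)
    finally show ?thesis
      using assms by simp
  qed
  have nat: "S (x + real n / real h) = S x" for x n
  proof (induction n)
    case (Suc n)
    thus ?case
      using step [of "x + real n / real h"] by (simp add: add_divide_distrib add_ac)
  qed simp
  have "S (x + of_int c / real h) = S x"
  proof (cases c rule: int_cases2)
    case (nonneg n)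
    thus ?thesis by (simp add: nat)
  next
    case (nonpos n)
    \<comment> \<open>A backward shift is a forward shift started from the shifted point.\<close>
    thus ?thesis using nat [of "x - real n / real h" n] by simp
  qed
  thus ?thesis by (simp add: S_def)
qed

lemma periodic_bernoulli_multiplication:
  assumes "h > 0"
  shows "periodic_bernoulli j (real h * x) =
    real h powi (int j - 1) * (\<Sum>\<nu><h. periodic_bernoulli j (x + real \<nu> / real h))"
proof -
  define y where "y = frac (real h * x) / real h"
  have x: "x = y + of_int \<lfloor>real h * x\<rfloor> / real h"
    using assms by (simp add: y_def frac_def field_simps)
  have frac: "frac (y + real \<nu> / real h) = y + real \<nu> / real h" if "\<nu> < h" for \<nu>
  proof -
    have "frac (real h * x) + real \<nu> < real h"
      using frac_lt_1 [of "real h * x"] that by linarith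
    thus ?thesis
      using assms by (simp add: frac_eq y_def add_divide_distrib [symmetric])
  qed
  have "(\<Sum>\<nu><h. periodic_bernoulli j (x + real \<nu> / real h)) =
      (\<Sum>\<nu><h. periodic_bernoulli j (y + real \<nu> / real h))"
    by (subst x, rule sum_shift_by_period) (simp_all add: periodic_bernoulli_def frac_1_eq assms)
  also have "\<dots> = (\<Sum>\<nu><h. bernoulli_poly j (y + real \<nu> / real h))"
    by (simp add: periodic_bernoulli_def frac)
  finally show ?thesis
    using bernoulli_poly_multiplication [OF assms, of j y] assms
    by (simp add: periodic_bernoulli_def y_def)
qed

lemma poly_dedekind_sum_expansion:
  assumes "m > 0" and "h > 0"
  shows "real h * real m ^ p * poly_dedekind_sum k p h m =
    (\<Sum>\<mu><m. \<Sum>j\<le>p. \<Sum>\<nu><h. (real m * real h) powi (int j - 1) * real (p choose j)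
       * polyexp_coeff k (p - j) * (real \<mu> * real h * real m ^ (p - j))
       * periodic_bernoulli j (real \<nu> / real h + real \<mu> / real m))"
proof -
  have "real h * real m ^ p * poly_dedekind_sum k p h m =
      (\<Sum>\<mu> = 1..m - 1. real h * real m ^ p *
        (real \<mu> / real m * periodic_poly_bernoulli k p (real h * (real \<mu> / real m))))"
    by (simp add: poly_dedekind_sum_def sum_distrib_left)
  also have "\<dots> = (\<Sum>\<mu><m. real h * real m ^ p *
        (real \<mu> / real m * periodic_poly_bernoulli k p (real h * (real \<mu> / real m))))"
    using assms by (intro sum.mono_neutral_left) auto
  also have "\<dots> = (\<Sum>\<mu><m. \<Sum>j\<le>p. real h * real m ^ p * (real \<mu> / real m *
        (real (p choose j) * polyexp_coeff k (p - j)
          * periodic_bernoulli j (real h * (real \<mu> / real m)))))"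
    unfolding periodic_poly_bernoulli_def poly_bernoulli_poly_eq_sum
      periodic_bernoulli_def [symmetric] sum_distrib_left atLeast0AtMost ..
  also have "\<dots> = (\<Sum>\<mu><m. \<Sum>j\<le>p. \<Sum>\<nu><h.
       (real m * real h) powi (int j - 1) * real (p choose j)
       * polyexp_coeff k (p - j) * (real \<mu> * real h * real m ^ (p - j))
       * periodic_bernoulli j (real \<nu> / real h + real \<mu> / real m))"
  proof (intro sum.cong refl)
    fix \<mu> j assume "j \<in> {..p}"
    hence "real m ^ p = real m ^ j * real m ^ (p - j)"
      by (simp add: power_add [symmetric])
    \<comment> \<open>This supplies the $m$ half of $(mh)^{j-1}$; the multiplication formula
      supplies the $h$ half.\<close>
    hence m: "real m ^ p / real m = real m powi (int j - 1) * real m ^ (p - j)"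
      using assms by (simp add: power_int_diff)
    have "real h * real m ^ p * (real \<mu> / real m *
          (real (p choose j) * polyexp_coeff k (p - j)
            * periodic_bernoulli j (real h * (real \<mu> / real m)))) =
        real h * (real m ^ p / real m) * real \<mu> * real (p choose j) * polyexp_coeff k (p - j)
            * periodic_bernoulli j (real h * (real \<mu> / real m))"
      by simp
    also have "\<dots> = (\<Sum>\<nu><h. (real m * real h) powi (int j - 1) * real (p choose j)
       * polyexp_coeff k (p - j) * (real \<mu> * real h * real m ^ (p - j))
       * periodic_bernoulli j (real \<nu> / real h + real \<mu> / real m))"
      unfolding m periodic_bernoulli_multiplication [OF assms(2)] sum_distrib_left
      by (simp add: power_int_mult_distrib mult_ac add.commute)
    finally show "real h * real m ^ p * (real \<mu> / real m *
          (real (p choose j) * polyexp_coeff k (p - j)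
            * periodic_bernoulli j (real h * (real \<mu> / real m)))) = \<dots>" .
  qed
  finally show ?thesis .
qed

theorem theorem10:
  fixes m h p :: nat and k :: int
  assumes "m > 0" and "h > 0" and "p > 0"
  shows "real h * real m ^ p * poly_dedekind_sum k p h m
       + real m * real h ^ p * poly_dedekind_sum k p m h
       = (\<Sum>\<mu> = 0..m - 1. \<Sum>j = 0..p. \<Sum>\<nu> = 0..h - 1. \<Sum>l = 1..p - j + 1.
            ((real m * real h) powi (int j - 1) * real (p choose j) * stirling1 (p - j + 1) l)
              / (real (p - j + 1) * real l powi (k - 1))
            * ((real \<mu> * real h) * real m ^ (p - j) + (real m * real \<nu>) * real h ^ (p - j))
            * periodic_bernoulli j (real \<nu> / real h + real \<mu> / real m))"
proof -
  \<comment> \<open>\<open>W\<close> collects the factors common to both expansions.\<close>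
  define W where "W = (\<lambda>\<mu> j \<nu>. (real m * real h) powi (int j - 1) * real (p choose j)
    * polyexp_coeff k (p - j) * periodic_bernoulli j (real \<nu> / real h + real \<mu> / real m))"
  have "real h * real m ^ p * poly_dedekind_sum k p h m =
      (\<Sum>\<mu><m. \<Sum>j\<le>p. \<Sum>\<nu><h. W \<mu> j \<nu> * (real \<mu> * real h * real m ^ (p - j)))"
    unfolding poly_dedekind_sum_expansion [OF assms(1,2)] W_def by (simp only: mult_ac)
  moreover have "real m * real h ^ p * poly_dedekind_sum k p m h =
      (\<Sum>\<mu><m. \<Sum>j\<le>p. \<Sum>\<nu><h. W \<mu> j \<nu> * (real m * real \<nu> * real h ^ (p - j)))"
  proof -
    have "real m * real h ^ p * poly_dedekind_sum k p m h =
        (\<Sum>\<nu><h. \<Sum>j\<le>p. \<Sum>\<mu><m. W \<mu> j \<nu> * (real m * real \<nu> * real h ^ (p - j)))"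
      unfolding poly_dedekind_sum_expansion [OF assms(2,1)] W_def
      by (simp only: mult_ac add.commute)
    also have "\<dots> = (\<Sum>j\<le>p. \<Sum>\<mu><m. \<Sum>\<nu><h. W \<mu> j \<nu> * (real m * real \<nu> * real h ^ (p - j)))"
      by (subst sum.swap) (intro sum.cong refl sum.swap)
    also have "\<dots> = (\<Sum>\<mu><m. \<Sum>j\<le>p. \<Sum>\<nu><h. W \<mu> j \<nu> * (real m * real \<nu> * real h ^ (p - j)))"
      by (rule sum.swap)
    finally show ?thesis .
  qed
  ultimately have "real h * real m ^ p * poly_dedekind_sum k p h m
      + real m * real h ^ p * poly_dedekind_sum k p m h =
      (\<Sum>\<mu><m. \<Sum>j\<le>p. \<Sum>\<nu><h. W \<mu> j \<nu> *
        (real \<mu> * real h * real m ^ (p - j) + real m * real \<nu> * real h ^ (p - j)))"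
    by (simp only: distrib_left sum.distrib)
  also have "\<dots> = (\<Sum>\<mu> = 0..m - 1. \<Sum>j = 0..p. \<Sum>\<nu> = 0..h - 1. W \<mu> j \<nu> *
        (real \<mu> * real h * real m ^ (p - j) + real m * real \<nu> * real h ^ (p - j)))"
  proof -
    \<comment> \<open>Positivity matters here: with truncated subtraction the right-hand sets are
      never empty.\<close>
    have "{..<m} = {0..m - 1}" "{..<h} = {0..h - 1}"
      using assms by auto
    thus ?thesis by (simp only: atLeast0AtMost)
  qed
  also have "\<dots> = (\<Sum>\<mu> = 0..m - 1. \<Sum>j = 0..p. \<Sum>\<nu> = 0..h - 1. \<Sum>l = 1..p - j + 1.
            ((real m * real h) powi (int j - 1) * real (p choose j) * stirling1 (p - j + 1) l)
              / (real (p - j + 1) * real l powi (k - 1))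
            * ((real \<mu> * real h) * real m ^ (p - j) + (real m * real \<nu>) * real h ^ (p - j))
            * periodic_bernoulli j (real \<nu> / real h + real \<mu> / real m))"
    unfolding W_def polyexp_coeff_def sum_distrib_left sum_distrib_right
    by (intro sum.cong refl) (simp only: times_divide_eq_left times_divide_eq_right mult_ac)
  finally show ?thesis .
qed

end
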